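(* Let $A,B\in\mathbb{Q}$ with $AB\neq 0$. The trinomial $x^4+Ax+B$ has reducibility type $(1,1,2)$ if and only if, up to scaling, $$A=-(u+1)(u^2+1),\qquad B=u(u^2+u+1)$$ for some $u\in\mathbb{Q}\setminus\{0,-1\}$, in which case the factorization is $$x^4+Ax+B=(x-1)(x-u)\bigl(x^2+(u+1)x+(u^2+u+1)\bigr).$$ Moreover, there are no trinomials $x^4+Ax+B$ with $A,B\in\mathbb{Q}$, $AB\ne0$, of reducibility type $(1,1,1,1)$.
   Context: A monic polynomial in $\mathbb{Q}[x]$ has reducibility type $(n_1,\dots,n_k)$, $n_1\le\dots\le n_k$, if it factors as a product of $k$ irreducible polynomials in $\mathbb{Q}[x]$ (not necessarily distinct) of degrees $n_1,\dots,n_k$. Trinomials are considered up to scaling: $x^n+Ax^m+B$ and $x^n+A\lambda^{n-m}x^m+B\lambda^n$ are identified for $\lambda\in\mathbb{Q}\setminus\{0\}$; "up to scaling $(A,B)=(A_0,B_0)$" means $(A,B)=(A_0\lambda^{n-m},B_0\lambda^n)$ for some $\lambda\in\mathbb{Q}\setminus\{0\}$ (and the factorization is that of the scaled trinomial). *)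

theory Defs
  imports "HOL-Computational_Algebra.Computational_Algebra"
begin

text \<open>The factors need not be distinct.\<close>

definition irreducible_factorization :: "rat poly \<Rightarrow> rat poly list \<Rightarrow> bool" where
  "irreducible_factorization p fs \<longleftrightarrow> p = prod_list fs \<and> (\<forall>f\<in>set fs. irreducible f)"

definition has_reducibility_type :: "rat poly \<Rightarrow> nat list \<Rightarrow> bool" where
  "has_reducibility_type p ns \<longleftrightarrow>
     lead_coeff p = 1 \<and> sorted ns \<and>
     (\<exists>fs. irreducible_factorization p fs \<and> map degree fs = ns)"

definition trinomial :: "nat \<Rightarrow> nat \<Rightarrow> rat \<Rightarrow> rat \<Rightarrow> rat poly" where
  "trinomial n m A B = monom 1 n + monom A m + [:B:]"

text \<open>The substitution \<open>x \<mapsto> x / l\<close> followed by multiplication with \<open>l ^ n\<close> takes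
  \<open>x ^ n + A\<^sub>0 x ^ m + B\<^sub>0\<close> to \<open>x ^ n + A\<^sub>0 l ^ (n - m) x ^ m + B\<^sub>0 l ^ n\<close>.
  The truncated subtraction is harmless because \<open>m < n\<close> for trinomials.\<close>

definition eq_up_to_scaling :: "nat \<Rightarrow> nat \<Rightarrow> rat \<times> rat \<Rightarrow> rat \<times> rat \<Rightarrow> bool" where
  "eq_up_to_scaling n m AB AB\<^sub>0 \<longleftrightarrow>
     (\<exists>l. l \<noteq> 0 \<and> AB = (fst AB\<^sub>0 * l ^ (n - m), snd AB\<^sub>0 * l ^ n))"

end

theory Submission
  imports Defs
begin

text \<open>A factorization with two linear factors is, after normalization,
  \<open>(x - r) (x - s) g\<close>. As the coefficients of \<open>x\<^sup>3\<close> and \<open>x\<^sup>2\<close> vanish, \<open>r\<close> and \<open>s\<close> determine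
  the monic quadratic \<open>g\<close>, and with it \<open>A\<close> and \<open>B\<close>; scaling by \<open>r\<close> and putting \<open>u = s / r\<close> gives
  the parametrization. Twice the value of \<open>g\<close> at \<open>x\<close> is \<open>(x + r)\<^sup>2 + (x + s)\<^sup>2 + (r + s)\<^sup>2\<close>,
  so \<open>g\<close> has no rational root and is always irreducible.\<close>

lemma degree_1_eq_smult_root:
  fixes p :: "'a::field poly"
  assumes "degree p = 1"
  obtains c x where "c \<noteq> 0" "p = smult c [:- x, 1:]"
proof -
  obtain a b where "p = [:b, a:]" "a \<noteq> 0"
    using degree1_coeffs[OF assms] by metis
  then have "p = smult a [:- (- b / a), 1:]"
    by simp
  with \<open>a \<noteq> 0\<close> show thesis ..
qed

lemma degree_1_imp_root:
  fixes p :: "'a::field poly"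
  assumes "degree p = 1"
  obtains x where "poly p x = 0"
proof -
  obtain c x where "p = smult c [:- x, 1:]"
    using degree_1_eq_smult_root[OF assms] by metis
  then have "poly p x = 0"
    by simp
  then show thesis ..
qed

lemma irreducible_degree_2_poly:
  fixes p :: "'a::field poly"
  assumes "degree p = 2" and no_root: "\<And>x. poly p x \<noteq> 0"
  shows "irreducible p"
proof (rule irreducibleI)
  show "p \<noteq> 0"
    using assms by auto
  then show "\<not> p dvd 1"
    using assms by (simp add: is_unit_iff_degree)
next
  fix a b assume p: "p = a * b"
  then have nz: "a \<noteq> 0" "b \<noteq> 0"
    using assms by auto
  have "degree a \<noteq> 1" "degree b \<noteq> 1"
    using no_root p by (metis degree_1_imp_root poly_mult mult_eq_0_iff)+
  moreover have "degree a + degree b = 2"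
    using assms(1) nz by (simp add: p degree_mult_eq)
  ultimately have "degree a = 0 \<or> degree b = 0"
    by linarith
  then show "a dvd 1 \<or> b dvd 1"
    using nz by (auto simp: is_unit_iff_degree)
qed

lemma cofactor_no_root:
  fixes r s x :: "'a::linordered_field"
  assumes "r \<noteq> 0"
  shows "poly [:r\<^sup>2 + r * s + s\<^sup>2, r + s, 1:] x \<noteq> 0"
proof
  assume "poly [:r\<^sup>2 + r * s + s\<^sup>2, r + s, 1:] x = 0"
  then have "(x + r)\<^sup>2 + (x + s)\<^sup>2 + (r + s)\<^sup>2 = 0"
    by (simp add: power2_eq_square algebra_simps)
  then have "(x + r)\<^sup>2 = 0 \<and> (x + s)\<^sup>2 = 0 \<and> (r + s)\<^sup>2 = 0"
    by (metis add_nonneg_eq_0_iff add_nonneg_nonneg zero_le_power2)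
  then have "x + r = 0" "x + s = 0" "r + s = 0"
    by auto
  \<comment> \<open>The first two equations give \<open>r = s\<close>, and the third then gives
    \<open>2 * r = 0\<close>.\<close>
  then have "2 * r = 0"
    by algebra
  with assms show False
    by simp
qed

lemma irreducible_cofactor:
  fixes r s :: rat
  assumes "r \<noteq> 0"
  shows "irreducible [:r\<^sup>2 + r * s + s\<^sup>2, r + s, 1:]"
  using cofactor_no_root[OF assms] by (intro irreducible_degree_2_poly) simp_all

lemma trinomial_4_1_eq: "trinomial 4 1 A B = [:B, A, 0, 0, 1:]"
  by (simp add: trinomial_def monom_altdef numeral_eq_Suc)

text \<open>Homogeneous form of the parametrization in terms of two roots: \<open>r = 1\<close>,
  \<open>s = u\<close> is the normalized trinomial, and \<open>r = l\<close>,
  \<open>s = u * l\<close> is its scaling by \<open>l\<close>.\<close>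

lemma trinomial_4_1_factorization:
  "trinomial 4 1 (- (r + s) * (r\<^sup>2 + s\<^sup>2)) (r * s * (r\<^sup>2 + r * s + s\<^sup>2)) =
     [:- r, 1:] * [:- s, 1:] * [:r\<^sup>2 + r * s + s\<^sup>2, r + s, 1:]"
  unfolding trinomial_4_1_eq by (simp add: power2_eq_square algebra_simps)

lemma irreducible_factorization_trinomial_4_1:
  assumes "r \<noteq> 0"
  shows "irreducible_factorization
    (trinomial 4 1 (- (r + s) * (r\<^sup>2 + s\<^sup>2)) (r * s * (r\<^sup>2 + r * s + s\<^sup>2)))
    [[:- r, 1:], [:- s, 1:], [:r\<^sup>2 + r * s + s\<^sup>2, r + s, 1:]]"
  unfolding irreducible_factorization_def trinomial_4_1_factorization
  using irreducible_cofactor[OF assms]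
  by (simp add: irreducible_linear_field_poly mult.assoc del: mult_pCons_left mult_pCons_right)

text \<open>Irreducibility of \<open>h\<close> is not assumed, so this serves both types: for
  \<open>[1, 1, 1, 1]\<close>, \<open>h\<close> is the product of the last two linear factors. The
  constant \<open>c\<close> makes \<open>h\<close> monic.\<close>

lemma trinomial_4_1_two_linear_factors:
  assumes eq: "trinomial 4 1 A B = f * g * h"
    and deg: "degree f = 1" "degree g = 1" "degree h = 2"
  obtains c r s where
    "A = - (r + s) * (r\<^sup>2 + s\<^sup>2)" "B = r * s * (r\<^sup>2 + r * s + s\<^sup>2)"
    "smult c h = [:r\<^sup>2 + r * s + s\<^sup>2, r + s, 1:]"
proof -
  obtain a r where f: "f = smult a [:- r, 1:]"
    using degree_1_eq_smult_root[OF deg(1)] by metis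
  obtain b s where g: "g = smult b [:- s, 1:]"
    using degree_1_eq_smult_root[OF deg(2)] by metis
  \<comment> \<open>\<open>q\<close> absorbs the leading coefficients of \<open>f\<close> and
    \<open>g\<close>, so that the two linear factors become monic.\<close>
  define q where "q = smult (a * b) h"
  define k0 k1 k2 where k: "k0 = coeff q 0" "k1 = coeff q 1" "k2 = coeff q 2"
  have "degree q \<le> 2"
    using degree_smult_le[of "a * b" h] deg(3) by (simp add: q_def)
  then have q: "q = [:k0, k1, k2:]"
    by (intro poly_eqI) (auto simp: k coeff_pCons coeff_eq_0 numeral_2_eq_2 split: nat.split)
  have "trinomial 4 1 A B = [:- r, 1:] * [:- s, 1:] * q"
    unfolding eq f g q_def by (simp only: mult_smult_left mult_smult_right smult_smult mult_ac)
  \<comment> \<open>Compare coefficients from degree 4 down to 0; in degree 2 this is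
    \<open>k0 = (r + s) * k1 - r * s * k2\<close>.\<close>
  then have *: "k2 = 1" "k1 = r + s" "k0 = r\<^sup>2 + r * s + s\<^sup>2"
    "A = - (r + s) * k0 + r * s * k1" "B = r * s * k0"
    unfolding trinomial_4_1_eq q by (auto simp: power2_eq_square algebra_simps)
  show thesis
  proof (rule that)
    show "A = - (r + s) * (r\<^sup>2 + s\<^sup>2)"
      unfolding *(4) *(2,3) by (simp add: power2_eq_square algebra_simps)
    show "B = r * s * (r\<^sup>2 + r * s + s\<^sup>2)"
      using * by simp
    show "smult (a * b) h = [:r\<^sup>2 + r * s + s\<^sup>2, r + s, 1:]"
      using * q by (simp add: q_def)
  qed
qed

text \<open>Lets \<open>auto\<close> split a list of factors with explicitly given degrees into
  named factors.\<close>

lemma map_degree_eq_Cons: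
  "map degree fs = n # ns \<longleftrightarrow> (\<exists>g gs. fs = g # gs \<and> degree g = n \<and> map degree gs = ns)"
  by (cases fs) auto

theorem theorem2p1:
  fixes A B :: rat
  assumes "A * B \<noteq> 0"
  shows "(has_reducibility_type (trinomial 4 1 A B) [1, 1, 2] \<longleftrightarrow>
           (\<exists>u. u \<notin> {0, -1} \<and>
              eq_up_to_scaling 4 1 (A, B) (- (u + 1) * (u\<^sup>2 + 1), u * (u\<^sup>2 + u + 1)))) \<and>
         (\<forall>u. u \<notin> {0, -1} \<longrightarrow>
           irreducible_factorization
             (trinomial 4 1 (- (u + 1) * (u\<^sup>2 + 1)) (u * (u\<^sup>2 + u + 1)))
             [[:-1, 1:], [:-u, 1:], [:u\<^sup>2 + u + 1, u + 1, 1:]]) \<and>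
         \<not> has_reducibility_type (trinomial 4 1 A B) [1, 1, 1, 1]"
proof (intro conjI iffI allI impI notI)
  assume "has_reducibility_type (trinomial 4 1 A B) [1, 1, 2]"
  then obtain f g h where "trinomial 4 1 A B = f * g * h"
    and "degree f = 1" "degree g = 1" "degree h = 2"
    by (auto simp: has_reducibility_type_def irreducible_factorization_def map_degree_eq_Cons
        mult.assoc)
  then obtain r s where A: "A = - (r + s) * (r\<^sup>2 + s\<^sup>2)"
    and B: "B = r * s * (r\<^sup>2 + r * s + s\<^sup>2)"
    by (rule trinomial_4_1_two_linear_factors)
  \<comment> \<open>\<open>r\<close> and \<open>s\<close> divide \<open>B\<close>, and
    \<open>r + s\<close> divides \<open>A\<close>. The last two facts exclude the values 0 and -1 of
    \<open>s / r\<close>.\<close>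
  have nz: "r \<noteq> 0" "s \<noteq> 0" "r + s \<noteq> 0"
    using assms by (auto simp: A B)
  show "\<exists>u. u \<notin> {0, -1} \<and>
      eq_up_to_scaling 4 1 (A, B) (- (u + 1) * (u\<^sup>2 + 1), u * (u\<^sup>2 + u + 1))"
  proof (intro exI conjI)
    show "s / r \<notin> {0, -1}"
      using nz by (auto simp: field_simps eq_neg_iff_add_eq_0)
    show "eq_up_to_scaling 4 1 (A, B)
        (- (s / r + 1) * ((s / r)\<^sup>2 + 1), s / r * ((s / r)\<^sup>2 + s / r + 1))"
      unfolding eq_up_to_scaling_def using nz(1)
      by (intro exI[of _ r]) (simp add: A B field_simps eval_nat_numeral)
  qed
next
  assume "\<exists>u. u \<notin> {0, -1} \<and>
      eq_up_to_scaling 4 1 (A, B) (- (u + 1) * (u\<^sup>2 + 1), u * (u\<^sup>2 + u + 1))"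
  then obtain u l where "l \<noteq> 0"
    and "A = - (u + 1) * (u\<^sup>2 + 1) * l ^ 3" "B = u * (u\<^sup>2 + u + 1) * l ^ 4"
    by (auto simp: eq_up_to_scaling_def)
  \<comment> \<open>Scaling by \<open>l\<close> moves the roots 1 and \<open>u\<close> to
    \<open>l\<close> and \<open>u * l\<close>.\<close>
  then have "A = - (l + u * l) * (l\<^sup>2 + (u * l)\<^sup>2)"
    "B = l * (u * l) * (l\<^sup>2 + l * (u * l) + (u * l)\<^sup>2)"
    by (simp_all add: algebra_simps eval_nat_numeral)
  with irreducible_factorization_trinomial_4_1[OF \<open>l \<noteq> 0\<close>, of "u * l"]
  have "irreducible_factorization (trinomial 4 1 A B)
      [[:- l, 1:], [:- (u * l), 1:], [:l\<^sup>2 + l * (u * l) + (u * l)\<^sup>2, l + u * l, 1:]]"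
    by simp
  moreover have "lead_coeff (trinomial 4 1 A B) = 1"
    unfolding trinomial_4_1_eq by simp
  ultimately show "has_reducibility_type (trinomial 4 1 A B) [1, 1, 2]"
    unfolding has_reducibility_type_def by fastforce
next
  fix u :: rat
  show "irreducible_factorization
      (trinomial 4 1 (- (u + 1) * (u\<^sup>2 + 1)) (u * (u\<^sup>2 + u + 1)))
      [[:-1, 1:], [:-u, 1:], [:u\<^sup>2 + u + 1, u + 1, 1:]]"
    using irreducible_factorization_trinomial_4_1[of 1 u] by (simp add: add_ac)
next
  assume "has_reducibility_type (trinomial 4 1 A B) [1, 1, 1, 1]"
  \<comment> \<open>Grouping the last two linear factors gives a quadratic that has a root, yet is
    proportional to the cofactor, which has none.\<close>
  then obtain f g h k where *: "trinomial 4 1 A B = f * g * (h * k)"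
    and deg: "degree f = 1" "degree g = 1" "degree h = 1" "degree k = 1"
    by (auto simp: has_reducibility_type_def irreducible_factorization_def map_degree_eq_Cons
        mult.assoc)
  have "h \<noteq> 0" "k \<noteq> 0"
    using deg by auto
  then have "degree (h * k) = 2"
    using deg by (simp add: degree_mult_eq)
  then obtain c r s where B: "B = r * s * (r\<^sup>2 + r * s + s\<^sup>2)"
    and hk: "smult c (h * k) = [:r\<^sup>2 + r * s + s\<^sup>2, r + s, 1:]"
    using trinomial_4_1_two_linear_factors[OF * deg(1,2)] by metis
  obtain x where "poly h x = 0"
    using degree_1_imp_root[OF deg(3)] .
  then have "poly (smult c (h * k)) x = 0"
    by simp
  moreover have "r \<noteq> 0"
    using assms by (auto simp: B)
  ultimately show False
    using cofactor_no_root unfolding hk by blast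
qed

end
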